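(* Let $M,N$ be typable terms of the simply typed $\lambda$-calculus such that $M\to_\beta N$. Then $\mathcal T^{\mathbf m}(M)>\mathcal T^{\mathbf m}(N)$ in the (strict) multiset order.
   Context: Simple types: $A::=\alpha\mid A\to B$ with $\alpha$ ranging over base types. Terms of the simply typed $\lambda$-calculus (STLC, Church style, up to $\alpha$-renaming): $M::=x^A\mid\lambda x^A.M\mid M\,N$, with usual typing; $\to_\beta$ is the closure under contexts of $(\lambda x.M)\,N\to_\beta M[x:=N]$. $\lambda^{\mathbf m}$-terms: $t,s::=x^A\mid\lambda x^A.t\mid t\,s\mid t\{s\}$ (up to $\alpha$-renaming). Typing: the usual STLC rules plus: $\Gamma\vdash t:A$ and $\Gamma\vdash s:B$ imply $\Gamma\vdash t\{s\}:A$. "Term" means typable term; types are unique. Every $\lambda$-term is also a $\lambda^{\mathbf m}$-term. Memories: $L::=\Box\mid L\{t\}$; if $L=\Box\{s_1\}\dots\{s_n\}$, then $tL$ denotes $t\{s_1\}\dots\{s_n\}$. Reduction $\to_{\mathbf m}$ is the closure under arbitrary contexts of $(\lambda x.t)L\,s\to_{\mathbf m}t[x:=s]\{s\}L$ (with $x$ not free in $L$). An $\mathbf m$-abstraction is a term $(\lambda x.t)L$; its degree is the height of its type, where $\mathsf h(\alpha)=0$, $\mathsf h(A\to B)=1+\max(\mathsf h(A),\mathsf h(B))$. A redex is a term $(\lambda x.t)L\,s$; its degree is that of $(\lambda x.t)L$. $\mathsf{maxdeg}(t)$ is the maximum degree of the redexes in $t$, or $0$ if there are none. $t\xrightarrow{d}_{\mathbf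 m}s$ means $t\to_{\mathbf m}s$ by contracting a redex of degree $d$. A reduction $\rho:t\xrightarrow{d}{}^*_{\mathbf m}t'$ is a finite (possibly empty) sequence of composable steps of degree $d$, where each step records the redex occurrence contracted. For each $t$ and $d\ge1$ the set of all reductions of degree $d$ starting from $t$ is finite. Multisets: $[x_1,\dots,x_n]$ denotes a finite multiset, $+$ is multiset sum, $\mathbb M(X)$ is the set of finite multisets over $X$. For an ordered set $(X,>)$, $\mathfrak m+[x]\succ^1\mathfrak m+\mathfrak n$ if $x>y$ for every $y\in\mathfrak n$; the multiset order $\succ$ is the transitive closure of $\succ^1$. Codomains: $\mathbb T_d=\mathbb M(\{(i,b)\mid 1\le i\le d,\ b\in\mathbb R_i\})$ for $d\ge0$ and $\mathbb R_d=\mathbb M(\mathbb T_{d-1})$ for $d\ge1$, ordered by the multiset order, with pairs ordered lexicographically: $(i,b)>(i',b')$ iff $i>i'$ or ($i=i'$ and $b\succ b'$). If $d\le d'$ then $\mathbb T_d\subseteq\mathbb T_{d'}$, compatibly with the orders. Measures, defined by mutual recursion on the degree: $\mathcal T^{\mathbf m}_{\le D}(t)\in\mathbb T_D$ ($D\ge0$) is the multiset containing one element $(d,\mathcal R^{\mathbf m}_d(t))$ for each redex occurrence in $t$ of degree $d\le D$; $\mathcal R^{\mathbf m}_D(t)\in\mathbb R_D$ ($D\ge1$) is the multiset containing one element $\mathcal T^{\mathbf m}_{\le D-1}(t')$ for each reduction $\rho:t\xrightarrow{D}{}^*_{\mathbf m}t'$ (with $t'$ arbitrary). For a typable $\lambda$-term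 $M$, $\mathcal T^{\mathbf m}(M)=\mathcal T^{\mathbf m}_{\le D}(M)$ with $D=\mathsf{maxdeg}(M)$. *)

theory Defs
  imports "HOL-Library.Multiset"
begin

section \<open>Types and terms\<close>

datatype 'b ty = Base 'b | Fun "'b ty" "'b ty"

primrec height :: "'b ty \<Rightarrow> nat" where
  "height (Base a) = 0"
| "height (Fun A B) = 1 + max (height A) (height B)"

text \<open>
  Terms up to renaming of bound variables are represented by de Bruijn indices. As in the
  Church-style presentation every variable occurrence carries its type; typing forces the
  annotation of an occurrence to agree with its binder or with the context.
\<close>

datatype 'b tm =
    Var nat "'b ty"
  | Lam "'b ty" "'b tm"
  | App "'b tm" "'b tm"
  | Mem "'b tm" "'b tm"  \<comment> \<open>\<open>t{s}\<close>\<close>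

inductive typing :: "'b ty list \<Rightarrow> 'b tm \<Rightarrow> 'b ty \<Rightarrow> bool" where
  "i < length \<Gamma> \<Longrightarrow> \<Gamma> ! i = A \<Longrightarrow> typing \<Gamma> (Var i A) A"
| "typing (A # \<Gamma>) t B \<Longrightarrow> typing \<Gamma> (Lam A t) (Fun A B)"
| "typing \<Gamma> t (Fun A B) \<Longrightarrow> typing \<Gamma> s A \<Longrightarrow> typing \<Gamma> (App t s) B"
| "typing \<Gamma> t A \<Longrightarrow> typing \<Gamma> s B \<Longrightarrow> typing \<Gamma> (Mem t s) A"

definition typable :: "'b tm \<Rightarrow> bool" where
  "typable t \<longleftrightarrow> (\<exists>\<Gamma> A. typing \<Gamma> t A)"

text \<open>
  The type of a typable term, read off the annotations (see \<open>typing_type_of\<close>); on an ill-typed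
  application the value is irrelevant.
\<close>

fun type_of :: "'b tm \<Rightarrow> 'b ty" where
  "type_of (Var i A) = A"
| "type_of (Lam A t) = Fun A (type_of t)"
| "type_of (App t s) = (case type_of t of Fun A B \<Rightarrow> B | Base a \<Rightarrow> Base a)"
| "type_of (Mem t s) = type_of t"

lemma typing_type_of: "typing \<Gamma> t A \<Longrightarrow> type_of t = A"
  by (induction rule: typing.induct) auto

text \<open>The terms of the simply typed lambda calculus are the terms without \<open>t{s}\<close>.\<close>

primrec lambda_term :: "'b tm \<Rightarrow> bool" where
  "lambda_term (Var i A) \<longleftrightarrow> True"
| "lambda_term (Lam A t) \<longleftrightarrow> lambda_term t"
| "lambda_term (App t s) \<longleftrightarrow> lambda_term t \<and> lambda_term s"
| "lambda_term (Mem t s) \<longleftrightarrow> False"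

primrec lift :: "'b tm \<Rightarrow> nat \<Rightarrow> 'b tm" where
  "lift (Var i A) k = Var (if i < k then i else Suc i) A"
| "lift (Lam A t) k = Lam A (lift t (Suc k))"
| "lift (App t s) k = App (lift t k) (lift s k)"
| "lift (Mem t s) k = Mem (lift t k) (lift s k)"

text \<open>
  \<open>subst t k s\<close> replaces index \<open>k\<close> by \<open>s\<close> and lowers the indices above \<open>k\<close>, because the binder
  of \<open>k\<close> disappears.
\<close>

primrec subst :: "'b tm \<Rightarrow> nat \<Rightarrow> 'b tm \<Rightarrow> 'b tm" where
  "subst (Var i A) k s = (if i < k then Var i A else if i = k then s else Var (i - 1) A)"
| "subst (Lam A t) k s = Lam A (subst t (Suc k) (lift s 0))"
| "subst (App t u) k s = App (subst t k s) (subst u k s)"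
| "subst (Mem t u) k s = Mem (subst t k s) (subst u k s)"

inductive beta :: "'b tm \<Rightarrow> 'b tm \<Rightarrow> bool"  (infix \<open>\<rightarrow>\<^sub>\<beta>\<close> 50) where
  "App (Lam A t) s \<rightarrow>\<^sub>\<beta> subst t 0 s"
| "t \<rightarrow>\<^sub>\<beta> t' \<Longrightarrow> Lam A t \<rightarrow>\<^sub>\<beta> Lam A t'"
| "t \<rightarrow>\<^sub>\<beta> t' \<Longrightarrow> App t s \<rightarrow>\<^sub>\<beta> App t' s"
| "s \<rightarrow>\<^sub>\<beta> s' \<Longrightarrow> App t s \<rightarrow>\<^sub>\<beta> App t s'"


section \<open>Reduction with memory\<close>

text \<open>A memory \<open>\<box>{s\<^sub>1}\<dots>{s\<^sub>n}\<close> is the list of its entries; \<open>mems t L\<close> is \<open>t{s\<^sub>1}\<dots>{s\<^sub>n}\<close>.\<close>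

definition mems :: "'b tm \<Rightarrow> 'b tm list \<Rightarrow> 'b tm" where
  "mems t L = foldl Mem t L"

text \<open>Positions of subterms: into the body of an abstraction, or the left or right immediate
  subterm of an application or of \<open>t{s}\<close>.\<close>

datatype dir = DBody | DLeft | DRight

type_synonym pos = "dir list"

text \<open>
  \<open>mstep p d t t'\<close>: contracting the redex of degree \<open>d\<close> at position \<open>p\<close> of \<open>t\<close> yields \<open>t'\<close>.
  The memory \<open>L\<close> lies outside the scope of the binder of the redex, so the side condition on
  free variables of \<open>L\<close> holds by construction.
\<close>

inductive mstep :: "pos \<Rightarrow> nat \<Rightarrow> 'b tm \<Rightarrow> 'b tm \<Rightarrow> bool" where
  "d = height (type_of (mems (Lam A t) L)) \<Longrightarrow>
     mstep [] d (App (mems (Lam A t) L) s) (mems (Mem (subst t 0 s) s) L)"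
| "mstep p d t t' \<Longrightarrow> mstep (DBody # p) d (Lam A t) (Lam A t')"
| "mstep p d t t' \<Longrightarrow> mstep (DLeft # p) d (App t s) (App t' s)"
| "mstep p d s s' \<Longrightarrow> mstep (DRight # p) d (App t s) (App t s')"
| "mstep p d t t' \<Longrightarrow> mstep (DLeft # p) d (Mem t s) (Mem t' s)"
| "mstep p d s s' \<Longrightarrow> mstep (DRight # p) d (Mem t s) (Mem t s')"

text \<open>The redex occurrences of a term with their degrees. Every redex can be contracted, so these
  are the positions at which a step is possible.\<close>

definition redex_occs :: "'b tm \<Rightarrow> (pos \<times> nat) set" where
  "redex_occs t = {(p, d). \<exists>t'. mstep p d t t'}"

inductive_cases mstep_VarE: "mstep p d (Var i A) u"
inductive_cases mstep_LamE: "mstep p d (Lam A t) u"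
inductive_cases mstep_AppE: "mstep p d (App t s) u"
inductive_cases mstep_MemE: "mstep p d (Mem t s) u"

lemmas mstep_tmE = mstep_VarE mstep_LamE mstep_AppE mstep_MemE

lemma finite_redex_occs: "finite (redex_occs t)"
proof (induction t)
  case (Var i A)
  have "redex_occs (Var i A) = {}" by (auto simp: redex_occs_def elim!: mstep_tmE)
  then show ?case by simp
next
  case (Lam A t)
  have "redex_occs (Lam A t) \<subseteq> (\<lambda>(p, d). (DBody # p, d)) ` redex_occs t"
    by (auto simp: redex_occs_def image_iff elim!: mstep_tmE)
  with Lam show ?case by (meson finite_imageI finite_subset)
next
  case (App t s)
  have "redex_occs (App t s) \<subseteq> {([], height (type_of t))}
      \<union> (\<lambda>(p, d). (DLeft # p, d)) ` redex_occs t \<union> (\<lambda>(p, d). (DRight # p, d)) ` redex_occs s"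
    by (auto simp: redex_occs_def image_iff elim!: mstep_tmE)
  with App show ?case by (meson finite.emptyI finite.insertI finite_UnI finite_imageI finite_subset)
next
  case (Mem t s)
  have "redex_occs (Mem t s) \<subseteq>
      (\<lambda>(p, d). (DLeft # p, d)) ` redex_occs t \<union> (\<lambda>(p, d). (DRight # p, d)) ` redex_occs s"
    by (auto simp: redex_occs_def image_iff elim!: mstep_tmE)
  with Mem show ?case by (meson finite_UnI finite_imageI finite_subset)
qed

lemma mems_Lam_inject: "mems (Lam A t) L = mems (Lam B u) K \<longleftrightarrow> A = B \<and> t = u \<and> L = K"
proof (induction L arbitrary: K rule: rev_induct)
  case Nil
  then show ?case by (cases K rule: rev_cases) (auto simp: mems_def)
next
  case (snoc s L)
  then show ?case by (cases K rule: rev_cases) (auto simp: mems_def)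
qed

lemma mstep_deterministic: "mstep p d t u \<Longrightarrow> mstep p d' t u' \<Longrightarrow> d = d' \<and> u = u'"
proof (induction arbitrary: d' u' rule: mstep.induct)
  case (1 d A t L s)
  from 1(2) show ?case
    by cases (use 1(1) in \<open>auto simp: mems_Lam_inject\<close>)
qed (erule mstep_tmE; fastforce)+

definition maxdeg :: "'b tm \<Rightarrow> nat" where
  "maxdeg t = Max (insert 0 (snd ` redex_occs t))"

text \<open>\<open>mreduction d t ps t'\<close>: contracting successively the redexes of degree \<open>d\<close> at the positions
  \<open>ps\<close> leads from \<open>t\<close> to \<open>t'\<close>. The source and \<open>ps\<close> determine the reduction sequence.\<close>

inductive mreduction :: "nat \<Rightarrow> 'b tm \<Rightarrow> pos list \<Rightarrow> 'b tm \<Rightarrow> bool" where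
  "mreduction d t [] t"
| "mstep p d t u \<Longrightarrow> mreduction d u ps v \<Longrightarrow> mreduction d t (p # ps) v"

definition mreductions :: "nat \<Rightarrow> 'b tm \<Rightarrow> (pos list \<times> 'b tm) set" where
  "mreductions d t = {(ps, t'). mreduction d t ps t'}"


section \<open>Codomains of the measures\<close>

text \<open>
  The sets \<open>\<T>\<^sub>d\<close> and \<open>\<R>\<^sub>d\<close> are subsets (\<open>in_T d\<close> and \<open>in_R d\<close>) of two mutually recursive types of
  hereditarily finite multisets.
\<close>

datatype tval = TV "(nat \<times> rval) multiset"
     and rval = RV "tval multiset"

inductive in_T :: "nat \<Rightarrow> tval \<Rightarrow> bool"
      and in_R :: "nat \<Rightarrow> rval \<Rightarrow> bool" where
  "(\<And>i b. (i, b) \<in># m \<Longrightarrow> 1 \<le> i \<and> i \<le> d \<and> in_R i b) \<Longrightarrow> in_T d (TV m)"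
| "(\<And>a. a \<in># m \<Longrightarrow> in_T d a) \<Longrightarrow> in_R (Suc d) (RV m)"

text \<open>
  The orders on the \<open>\<T>\<^sub>d\<close> (and on the \<open>\<R>\<^sub>d\<close>) are compatible for different \<open>d\<close> and are restrictions
  of a single relation on the whole type. The smaller argument comes first, as in \<open>multp\<close>.
\<close>

inductive less_T :: "tval \<Rightarrow> tval \<Rightarrow> bool"
      and less_R :: "rval \<Rightarrow> rval \<Rightarrow> bool" where
  "multp (\<lambda>x y. fst x < fst y \<or> fst x = fst y \<and> less_R (snd x) (snd y)) m n \<Longrightarrow>
     less_T (TV m) (TV n)"
| "multp less_T m n \<Longrightarrow> less_R (RV m) (RV n)"


section \<open>The measures\<close>

text \<open>
  \<open>measure_R\<close> is only meaningful at positive degrees. The sets of redex occurrences and, for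
  typable terms and positive degrees, of reductions of a fixed degree are finite, so that
  \<open>mset_set\<close> contains each of their elements exactly once.
\<close>

function measure_T :: "nat \<Rightarrow> 'b tm \<Rightarrow> tval"
     and measure_R :: "nat \<Rightarrow> 'b tm \<Rightarrow> rval" where
  "measure_T D t =
     TV (image_mset (\<lambda>(p, d). (d, measure_R d t)) (mset_set {(p, d) \<in> redex_occs t. d \<le> D}))"
| "measure_R (Suc D) t =
     RV (image_mset (\<lambda>(ps, t'). measure_T D t') (mset_set (mreductions (Suc D) t)))"
| "measure_R 0 t = RV {#}"
  by pat_completeness auto
termination
proof (relation "measure (\<lambda>x. case x of Inl (D, t) \<Rightarrow> 2 * D + 1 | Inr (D, t) \<Rightarrow> 2 * D)",
       goal_cases)
  case (2 D t x p d)
  then have "x \<in> {(p, d) \<in> redex_occs t. d \<le> D}"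
    by (metis (lifting) elem_mset_set infinite_set_mset_mset_set empty_iff)
  with 2 show ?case by auto
qed auto

lemma measure_T_in_T: "in_T D (measure_T D t)"
  and measure_R_in_R: "D \<ge> 1 \<Longrightarrow> in_R D (measure_R D t)"
proof (induction D t and D t rule: measure_T_measure_R.induct)
  case (1 D t)
  have fin: "finite {(p, d) \<in> redex_occs t. d \<le> D}"
    by (rule finite_subset[OF _ finite_redex_occs[of t]]) auto
  have pos: "1 \<le> d" if "mstep p d t t'" for p d and t t' :: "'b tm"
    using that
  proof (induction rule: mstep.induct)
    case (1 d A t L s)
    have "type_of (mems (Lam A t) L) = Fun A (type_of t)"
      by (induction L rule: rev_induct) (auto simp: mems_def)
    with 1 show ?case by simp
  qed auto
  show ?case
    unfolding measure_T.simps
    by (rule in_T_in_R.intros(1))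
      (use 1 fin pos in \<open>fastforce simp: redex_occs_def\<close>)
next
  case (2 D t)
  show ?case
    unfolding measure_R.simps
    by (rule in_T_in_R.intros(2)) (use 2 in fastforce)
qed simp

definition measure_m :: "'b tm \<Rightarrow> tval" where
  "measure_m t = measure_T (maxdeg t) t"

end

theory Submission
  imports Defs "HOL-Library.Disjoint_Sets"
begin

text \<open>
  A beta step is a step of the calculus with memory followed by the erasure of an entry, so it
  suffices that erasing never increases the measures and that a step of degree \<open>d\<close> strictly
  decreases \<open>measure_T D\<close> for \<open>d \<le> D\<close>. The latter is by induction on \<open>D\<close>. Let \<open>t\<close> reduce to \<open>u\<close> by a step of
  degree \<open>d\<close>. At degree \<open>d\<close> the reductions from \<open>u\<close> are among those from \<open>t\<close>. At a degree
  \<open>e > d\<close> the step may duplicate redexes, but creates none. There every \<open>s\<close> reachable from \<open>u\<close> by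
  steps of degree \<open>e\<close> has the same normal form of degree \<open>e\<close> as \<open>u\<close>. As nothing is ever erased,
  passing to this normal form can only increase the measures of degree below \<open>e\<close>. Finally, the
  normal form of \<open>t\<close>, which is reachable from \<open>t\<close>, reduces to that of \<open>u\<close> by at least one step of
  degree \<open>d\<close>, so it strictly dominates \<open>s\<close> by the induction hypothesis.
\<close>


section \<open>Substitution and typing\<close>

lemma lift_lift: "i < k + 1 \<Longrightarrow> lift (lift t i) (Suc k) = lift (lift t k) i"
  by (induction t arbitrary: i k) auto

lemma lift_subst: "j < i + 1 \<Longrightarrow> lift (subst t j s) i = subst (lift t (i + 1)) j (lift s i)"
  by (induction t arbitrary: i j s) (auto simp: diff_Suc lift_lift split: nat.split)

lemma lift_subst_lt: "i < j + 1 \<Longrightarrow> lift (subst t j s) i = subst (lift t i) (j + 1) (lift s i)"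
  by (induction t arbitrary: i j s) (auto simp: lift_lift)

lemma subst_lift [simp]: "subst (lift t k) k s = t"
  by (induction t arbitrary: k s) simp_all

lemma subst_subst:
  "i < j + 1 \<Longrightarrow>
    subst (subst t (Suc j) (lift v i)) i (subst u j v) = subst (subst t i u) j v"
  by (induction t arbitrary: i j u v)
    (auto simp: diff_Suc lift_lift [symmetric] lift_subst_lt split: nat.split)

lemma type_of_lift [simp]: "type_of (lift t k) = type_of t"
  by (induction t arbitrary: k) auto

inductive_cases typing_VarE: "typing \<Gamma> (Var i A) B"
inductive_cases typing_LamE: "typing \<Gamma> (Lam A t) B"
inductive_cases typing_AppE: "typing \<Gamma> (App t s) B"
inductive_cases typing_MemE: "typing \<Gamma> (Mem t s) B"

lemmas typing_tmE = typing_VarE typing_LamE typing_AppE typing_MemE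

lemma typing_lift: "typing (\<Gamma> @ \<Delta>) t B \<Longrightarrow> typing (\<Gamma> @ A # \<Delta>) (lift t (length \<Gamma>)) B"
proof (induction t arbitrary: \<Gamma> B)
  case (Var i C)
  then show ?case
    by (auto elim!: typing_VarE intro!: typing.intros simp: nth_append Suc_diff_le)
next
  case (Lam C t)
  from Lam.prems show ?case
    using Lam.IH[of "C # \<Gamma>"] by (auto elim!: typing_LamE intro!: typing.intros)
qed (auto elim!: typing_tmE; blast intro: typing.intros)+

lemma typing_subst:
  "typing (\<Gamma> @ A # \<Delta>) t B \<Longrightarrow> typing (\<Gamma> @ \<Delta>) s A \<Longrightarrow>
    typing (\<Gamma> @ \<Delta>) (subst t (length \<Gamma>) s) B"
proof (induction t arbitrary: \<Gamma> B s)
  case (Var i C)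
  then show ?case
    by (auto elim!: typing_VarE intro!: typing.intros simp: nth_append nth_Cons' split: if_splits)
next
  case (Lam C t)
  from Lam.prems show ?case
    using Lam.IH[of "C # \<Gamma>"] typing_lift[of "[]" "\<Gamma> @ \<Delta>"]
    by (auto elim!: typing_LamE intro!: typing.intros)
qed (auto elim!: typing_tmE; blast intro: typing.intros)+


section \<open>Reducts\<close>

text \<open>The shape \<open>mems (Lam A u) L\<close> as a structural predicate, so that proofs go
  by induction on the term; \<open>m_abs_iff_mems\<close> shows the agreement.\<close>

primrec m_abs :: "'b tm \<Rightarrow> bool" where
  "m_abs (Var i A) \<longleftrightarrow> False"
| "m_abs (Lam A t) \<longleftrightarrow> True"
| "m_abs (App t s) \<longleftrightarrow> False"
| "m_abs (Mem t s) \<longleftrightarrow> m_abs t"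

definition m_abs_of_deg :: "nat \<Rightarrow> 'b tm \<Rightarrow> bool" where
  "m_abs_of_deg d t \<longleftrightarrow> m_abs t \<and> height (type_of t) = d"

text \<open>The contractum of \<open>App t s\<close> when \<open>t\<close> is an abstraction under a
  memory. The values on other terms are chosen so that \<open>contract_lift\<close> and
  \<open>reduces_contract_right\<close> hold unconditionally.\<close>

primrec contract :: "'b tm \<Rightarrow> 'b tm \<Rightarrow> 'b tm" where
  "contract (Var i A) s = App (Var i A) s"
| "contract (Lam A t) s = Mem (subst t 0 s) s"
| "contract (App t u) s = App (App t u) s"
| "contract (Mem t u) s = Mem (contract t s) u"

text \<open>A multiset, because the measures count redex occurrences: two of them contribute twice
  even if they lead to the same term. Positions are forgotten; \<open>reducts_eq\<close> gives the
  link with \<open>mstep\<close>.\<close>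

primrec reducts :: "nat \<Rightarrow> 'b tm \<Rightarrow> 'b tm multiset" where
  "reducts d (Var i A) = {#}"
| "reducts d (Lam A t) = image_mset (Lam A) (reducts d t)"
| "reducts d (App t s) = (if m_abs_of_deg d t then {#contract t s#} else {#})
     + image_mset (\<lambda>t'. App t' s) (reducts d t) + image_mset (App t) (reducts d s)"
| "reducts d (Mem t s) =
     image_mset (\<lambda>t'. Mem t' s) (reducts d t) + image_mset (Mem t) (reducts d s)"

abbreviation reduces :: "nat \<Rightarrow> 'b tm \<Rightarrow> 'b tm \<Rightarrow> bool" where
  "reduces d \<equiv> (\<lambda>t u. u \<in># reducts d t)\<^sup>*\<^sup>*"

lemma m_abs_lift [simp]: "m_abs (lift t k) = m_abs t"
  by (induction t) auto

lemma m_abs_of_deg_lift [simp]: "m_abs_of_deg d (lift t k) = m_abs_of_deg d t"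
  by (simp add: m_abs_of_deg_def)

lemma contract_lift: "contract (lift t k) (lift s k) = lift (contract t s) k"
  by (induction t) (auto simp: lift_subst)

lemma m_abs_subst: "m_abs t \<Longrightarrow> m_abs (subst t k s)"
  by (induction t) auto

lemma contract_subst:
  "m_abs t \<Longrightarrow> contract (subst t k r) (subst s k r) = subst (contract t s) k r"
  by (induction t) (auto simp: subst_subst[of 0, simplified])

text \<open>A term that only becomes an abstraction by the substitution must be the substituted
  variable itself, possibly under memory entries. Redexes created by a substitution therefore have
  degree \<open>height A\<close>.\<close>

lemma m_abs_subst_typing:
  assumes "typing (\<Gamma> @ A # \<Delta>) t B" "m_abs (subst t (length \<Gamma>) s)" "\<not> m_abs t"
  shows "B = A"
  using assms by (induction t arbitrary: B) (auto elim!: typing_tmE simp: nth_append split: if_splits)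

lemma m_abs_height_pos: "m_abs t \<Longrightarrow> 0 < height (type_of t)"
  by (induction t) auto

lemma typing_contract:
  "typing \<Gamma> t (Fun A B) \<Longrightarrow> typing \<Gamma> s A \<Longrightarrow> typing \<Gamma> (contract t s) B"
proof (induction t)
  case (Lam C t)
  then show ?case using typing_subst[of "[]"]
    by (auto elim!: typing_LamE intro!: typing.intros)
qed (auto elim: typing_MemE intro: typing.intros)

section \<open>Subject reduction and preservation of abstractions\<close>

lemma typing_reducts: "u \<in># reducts d t \<Longrightarrow> typing \<Gamma> t A \<Longrightarrow> typing \<Gamma> u A"
proof (induction t arbitrary: \<Gamma> A u)
  case (App t s)
  then show ?case
    by (auto elim!: typing_tmE split: if_splits intro: typing_contract typing.intros)
qed (auto elim!: typing_tmE; blast intro: typing.intros)+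

lemma typing_reduces: "reduces d t u \<Longrightarrow> typing \<Gamma> t A \<Longrightarrow> typing \<Gamma> u A"
  by (induction rule: rtranclp_induct) (auto intro: typing_reducts)

lemma typable_reducts: "u \<in># reducts d t \<Longrightarrow> typable t \<Longrightarrow> typable u"
  unfolding typable_def using typing_reducts by blast

lemma typable_reduces: "reduces d t u \<Longrightarrow> typable t \<Longrightarrow> typable u"
  unfolding typable_def using typing_reduces by blast

lemma m_abs_reducts: "u \<in># reducts d t \<Longrightarrow> m_abs t \<Longrightarrow> m_abs u"
  by (induction t arbitrary: u) auto

lemma m_abs_reduces: "reduces d t u \<Longrightarrow> m_abs t \<Longrightarrow> m_abs u"
  by (induction rule: rtranclp_induct) (auto intro: m_abs_reducts)

lemma m_abs_contract_height:
  assumes "typing \<Gamma> t (Fun A B)" "m_abs t"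
  shows "height B < height (type_of t) \<and> height A < height (type_of t)"
  using assms typing_type_of by fastforce

text \<open>A step creates only abstractions of smaller degree, because the type of a contracted
  redex is a proper part of the type of its abstraction.\<close>

lemma m_abs_created:
  assumes "u \<in># reducts d t" "typing \<Gamma> t A" "m_abs u" "\<not> m_abs t"
  shows "height A < d"
  using assms
proof (induction t arbitrary: A u)
  case (App t s)
  then show ?case
    by (auto elim!: typing_AppE simp: m_abs_of_deg_def dest: m_abs_contract_height split: if_splits)
qed (auto elim!: typing_tmE)

lemma m_abs_created_reduces:
  assumes "reduces d t u" "typing \<Gamma> t A" "m_abs u" "\<not> m_abs t"
  shows "height A < d"
  using assms
proof (induction rule: rtranclp_induct)
  case (step u v)
  then show ?case using m_abs_created[of v d u \<Gamma> A] typing_reduces[of d t u \<Gamma> A] by blast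
qed simp

section \<open>Reduction under contexts, substitution and contraction\<close>

lemma reduces_map:
  assumes "reduces d t u" "\<And>t u. u \<in># reducts d t \<Longrightarrow> f u \<in># reducts d (f t)"
  shows "reduces d (f t) (f u)"
  using assms(1) by (induction rule: rtranclp_induct) (auto intro: assms(2) rtranclp.rtrancl_into_rtrancl)

lemma reduces_Lam: "reduces d t u \<Longrightarrow> reduces d (Lam A t) (Lam A u)"
  by (rule reduces_map) auto

lemma reduces_App: "reduces d t t' \<Longrightarrow> reduces d s s' \<Longrightarrow> reduces d (App t s) (App t' s')"
  using reduces_map[of d t t' "\<lambda>t. App t s"] reduces_map[of d s s' "App t'"]
  by (auto intro: rtranclp_trans)

lemma reduces_Mem: "reduces d t t' \<Longrightarrow> reduces d s s' \<Longrightarrow> reduces d (Mem t s) (Mem t' s')"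
  using reduces_map[of d t t' "\<lambda>t. Mem t s"] reduces_map[of d s s' "Mem t'"]
  by (auto intro: rtranclp_trans)

lemma reducts_lift: "reducts d (lift t k) = image_mset (\<lambda>u. lift u k) (reducts d t)"
  by (induction t arbitrary: k) (auto simp: contract_lift image_mset.compositionality o_def)

lemma reduces_lift: "reduces d t u \<Longrightarrow> reduces d (lift t k) (lift u k)"
  by (rule reduces_map) (auto simp: reducts_lift)

lemma reduces_subst_right: "reduces d s s' \<Longrightarrow> reduces d (subst t k s) (subst t k s')"
  by (induction t arbitrary: k s s') (simp_all add: reduces_Lam reduces_App reduces_Mem reduces_lift)

lemma type_of_subst:
  "typing (\<Gamma> @ A # \<Delta>) t B \<Longrightarrow> typing (\<Gamma> @ \<Delta>) s A \<Longrightarrow> type_of (subst t (length \<Gamma>) s) = type_of t"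
  using typing_subst typing_type_of by metis

lemma m_abs_of_deg_subst:
  "typing (\<Gamma> @ A # \<Delta>) t B \<Longrightarrow> typing (\<Gamma> @ \<Delta>) s A \<Longrightarrow> m_abs_of_deg d t \<Longrightarrow>
    m_abs_of_deg d (subst t (length \<Gamma>) s)"
  by (simp add: m_abs_of_deg_def m_abs_subst type_of_subst)

text \<open>No redex of \<open>t\<close> is lost: abstractions stay abstractions and by typing keep
  their degree. The surplus on the right consists of redexes in copies of \<open>s\<close> and of
  created ones.\<close>

lemma reducts_subst_left:
  assumes "typing (\<Gamma> @ A # \<Delta>) t B" "typing (\<Gamma> @ \<Delta>) s A"
  shows "image_mset (\<lambda>u. subst u (length \<Gamma>) s) (reducts d t)
    \<subseteq># reducts d (subst t (length \<Gamma>) s)"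
  using assms
proof (induction t arbitrary: \<Gamma> B s)
  case (Lam C t)
  then obtain B' where "typing ((C # \<Gamma>) @ A # \<Delta>) t B'"
    by (auto elim: typing_LamE)
  moreover have "typing ((C # \<Gamma>) @ \<Delta>) (lift s 0) A"
    using typing_lift[of "[]"] Lam.prems by simp
  ultimately have "image_mset (\<lambda>u. subst u (length (C # \<Gamma>)) (lift s 0)) (reducts d t)
    \<subseteq># reducts d (subst t (length (C # \<Gamma>)) (lift s 0))"
    by (rule Lam.IH)
  from image_mset_subseteq_mono[OF this, of "Lam C"] show ?case
    by (simp add: image_mset.compositionality o_def)
next
  case (App t r)
  then obtain C where t: "typing (\<Gamma> @ A # \<Delta>) t (Fun C B)" and r: "typing (\<Gamma> @ A # \<Delta>) r C"
    by (auto elim: typing_AppE)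
  note IH = App.IH(1)[OF t App.prems(2)] App.IH(2)[OF r App.prems(2)]
  let ?f = "\<lambda>u. subst u (length \<Gamma>) s"
  have "image_mset (\<lambda>u. App u (?f r)) (image_mset ?f (reducts d t))
      + image_mset (App (?f t)) (image_mset ?f (reducts d r))
      \<subseteq># image_mset (\<lambda>u. App u (?f r)) (reducts d (?f t)) + image_mset (App (?f t)) (reducts d (?f r))"
    using IH by (intro subset_mset.add_mono image_mset_subseteq_mono)
  moreover have "image_mset ?f (if m_abs_of_deg d t then {#contract t r#} else {#})
      \<subseteq># (if m_abs_of_deg d (?f t) then {#contract (?f t) (?f r)#} else {#})"
    using m_abs_of_deg_subst[OF t App.prems(2)] by (auto simp: contract_subst m_abs_of_deg_def)
  ultimately show ?case
    by (auto simp only: reducts.simps subst.simps image_mset_union image_mset.compositionality o_def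
        add.assoc intro: subset_mset.add_mono)
next
  case (Mem t r)
  then obtain C where t: "typing (\<Gamma> @ A # \<Delta>) t B" and r: "typing (\<Gamma> @ A # \<Delta>) r C"
    by (auto elim: typing_MemE)
  note IH = Mem.IH(1)[OF t Mem.prems(2)] Mem.IH(2)[OF r Mem.prems(2)]
  let ?f = "\<lambda>u. subst u (length \<Gamma>) s"
  have "image_mset (\<lambda>u. Mem u (?f r)) (image_mset ?f (reducts d t))
      + image_mset (Mem (?f t)) (image_mset ?f (reducts d r))
      \<subseteq># image_mset (\<lambda>u. Mem u (?f r)) (reducts d (?f t)) + image_mset (Mem (?f t)) (reducts d (?f r))"
    using IH by (intro subset_mset.add_mono image_mset_subseteq_mono)
  then show ?case
    by (simp add: image_mset.compositionality o_def)
qed simp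

text \<open>Contraction stores \<open>s\<close> as a memory entry even if the bound variable does
  not occur, so redexes of \<open>s\<close> survive. The map \<open>g\<close> contracts such a redex
  in the stored copy only, apart from all redexes of \<open>t\<close>; reducing the substituted
  copies as well then leads to \<open>contract t r\<close>.\<close>

lemma reducts_contract:
  assumes "typing \<Gamma> t (Fun A B)" "typing \<Gamma> s A" "m_abs t"
  shows "\<exists>g. image_mset (\<lambda>u. contract u s) (reducts d t) + image_mset g (reducts d s)
      \<subseteq># reducts d (contract t s) \<and> (\<forall>r\<in>#reducts d s. reduces d (g r) (contract t r))"
  using assms(1,3)
proof (induction t)
  case (Lam C t)
  from Lam.prems(1) have t: "typing ([] @ A # \<Gamma>) t B"
    by (auto elim: typing_LamE)
  let ?g = "Mem (subst t 0 s)"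
  have "image_mset (\<lambda>u. Mem u s) (image_mset (\<lambda>u. subst u 0 s) (reducts d t)) + image_mset ?g (reducts d s)
      \<subseteq># reducts d (contract (Lam C t) s)"
    using reducts_subst_left[OF t, of s d] assms(2)
    by (auto intro!: subset_mset.add_mono image_mset_subseteq_mono)
  moreover have "reduces d (?g r) (contract (Lam C t) r)" if "r \<in># reducts d s" for r
    using that by (auto intro!: reduces_Mem reduces_subst_right)
  ultimately show ?case
    by (intro exI[of _ ?g]) (simp add: image_mset.compositionality o_def)
next
  case (Mem t r)
  then obtain g where g: "image_mset (\<lambda>u. contract u s) (reducts d t) + image_mset g (reducts d s)
      \<subseteq># reducts d (contract t s)" "\<forall>r\<in>#reducts d s. reduces d (g r) (contract t r)"
    by (auto elim: typing_MemE)
  let ?g = "\<lambda>u. Mem (g u) r"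
  have "image_mset (\<lambda>u. Mem u r) (image_mset (\<lambda>u. contract u s) (reducts d t) + image_mset g (reducts d s))
      + image_mset (Mem (contract t s)) (reducts d r) \<subseteq># reducts d (contract (Mem t r) s)"
    using g(1) by (auto intro!: subset_mset.add_mono image_mset_subseteq_mono simp del: image_mset_union)
  moreover have "reduces d (?g q) (contract (Mem t r) q)" if "q \<in># reducts d s" for q
    using that g(2) by (auto intro!: reduces_Mem)
  ultimately show ?case
    by (intro exI[of _ ?g]) (simp add: image_mset.compositionality o_def ac_simps)
qed auto

lemma reduces_contract_left:
  assumes "reduces d t u" "typing \<Gamma> t (Fun A B)" "typing \<Gamma> s A" "m_abs t"
  shows "reduces d (contract t s) (contract u s)"
  using assms
proof (induction rule: rtranclp_induct)
  case (step u v)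
  then have "typing \<Gamma> u (Fun A B)" "m_abs u"
    using typing_reduces[of d t u] m_abs_reduces[of d t u] by auto
  then obtain g where "image_mset (\<lambda>u. contract u s) (reducts d u) + image_mset g (reducts d s)
      \<subseteq># reducts d (contract u s)"
    using reducts_contract step.prems(2) by blast
  then have "contract v s \<in># reducts d (contract u s)"
    by (rule mset_subset_eqD) (use step.hyps in auto)
  with step.IH[OF step.prems] show ?case by (rule rtranclp.rtrancl_into_rtrancl)
qed simp

lemma reduces_contract_right: "reduces d s s' \<Longrightarrow> reduces d (contract t s) (contract t s')"
  by (induction t) (auto intro: reduces_Mem reduces_App reduces_subst_right)


section \<open>The normal form of a given degree\<close>

definition app_deg :: "nat \<Rightarrow> 'b tm \<Rightarrow> 'b tm \<Rightarrow> 'b tm" where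
  "app_deg d t s = (if m_abs_of_deg d t then contract t s else App t s)"

text \<open>Contracts the redexes of degree \<open>d\<close> from the inside out. On typable terms
  the result is the normal form of degree \<open>d\<close>: it is invariant under such steps by
  \<open>develop_reducts\<close>, and as each of them adds memory entries, none can start from
  it.\<close>

primrec develop :: "nat \<Rightarrow> 'b tm \<Rightarrow> 'b tm" where
  "develop d (Var i A) = Var i A"
| "develop d (Lam A t) = Lam A (develop d t)"
| "develop d (App t s) = app_deg d (develop d t) (develop d s)"
| "develop d (Mem t s) = Mem (develop d t) (develop d s)"

lemma reduces_develop: "reduces d t (develop d t)"
proof (induction t)
  case (App t s)
  then have "reduces d (App t s) (App (develop d t) (develop d s))" by (rule reduces_App)
  moreover have "reduces d (App (develop d t) (develop d s)) (develop d (App t s))"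
    by (auto simp: app_deg_def)
  ultimately show ?case by (rule rtranclp_trans)
qed (auto intro: reduces_Lam reduces_Mem)

lemma typing_develop: "typing \<Gamma> t A \<Longrightarrow> typing \<Gamma> (develop d t) A"
  using typing_reduces[OF reduces_develop] .

lemma typable_develop: "typable t \<Longrightarrow> typable (develop d t)"
  using typable_reduces[OF reduces_develop] .

lemma m_abs_develop: "m_abs t \<Longrightarrow> m_abs (develop d t)"
  by (induction t) auto

lemma develop_lift: "develop d (lift t k) = lift (develop d t) k"
  by (induction t arbitrary: k) (auto simp: app_deg_def contract_lift)

text \<open>A redex created by the substitution has degree \<open>height A < d\<close>, so the
  development meets no redexes of degree \<open>d\<close> beyond those of \<open>t\<close> and of
  the copies of \<open>s\<close>.\<close>

lemma develop_subst:
  assumes "typing (\<Gamma> @ A # \<Delta>) t B" "typing (\<Gamma> @ \<Delta>) s A" "height A < d"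
  shows "develop d (subst t (length \<Gamma>) s) = subst (develop d t) (length \<Gamma>) (develop d s)"
  using assms(1,2)
proof (induction t arbitrary: \<Gamma> B s)
  case (Lam C t)
  then obtain B' where "typing ((C # \<Gamma>) @ A # \<Delta>) t B'"
    by (auto elim: typing_LamE)
  moreover have "typing ((C # \<Gamma>) @ \<Delta>) (lift s 0) A"
    using typing_lift[of "[]"] Lam.prems by simp
  ultimately have "develop d (subst t (length (C # \<Gamma>)) (lift s 0))
    = subst (develop d t) (length (C # \<Gamma>)) (develop d (lift s 0))"
    by (rule Lam.IH)
  then show ?case by (simp add: develop_lift)
next
  case (App t r)
  then obtain C where t: "typing (\<Gamma> @ A # \<Delta>) t (Fun C B)" and r: "typing (\<Gamma> @ A # \<Delta>) r C"
    by (auto elim: typing_AppE)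
  let ?f = "\<lambda>u. subst u (length \<Gamma>) (develop d s)"
  note IH = App.IH(1)[OF t App.prems(2)] App.IH(2)[OF r App.prems(2)]
  note t' = typing_develop[OF t, of d] and s' = typing_develop[OF App.prems(2), of d]
  have "m_abs_of_deg d (?f (develop d t)) \<longleftrightarrow> m_abs_of_deg d (develop d t)"
    using m_abs_subst[of "develop d t"] m_abs_subst_typing[OF t', of "develop d s"] assms(3)
      typing_type_of[OF t'] typing_type_of[OF typing_subst[OF t' s']]
    unfolding m_abs_of_deg_def by (metis less_irrefl)
  then show ?case
    using IH by (auto simp: app_deg_def m_abs_of_deg_def contract_subst)
qed (auto elim!: typing_tmE)

lemma develop_contract:
  assumes "typing \<Gamma> t (Fun A B)" "typing \<Gamma> s A" "m_abs t" "height A < d"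
  shows "develop d (contract t s) = contract (develop d t) (develop d s)"
  using assms
proof (induction t)
  case (Lam C t)
  then show ?case using develop_subst[of "[]" A \<Gamma> t B s d] by (auto elim!: typing_LamE)
qed (auto elim: typing_MemE)

text \<open>The critical case is a contraction at the root. There the type of the argument has
  height below the degree \<open>d\<close> of the head, so developing commutes with the contraction
  by \<open>develop_contract\<close>.\<close>

lemma develop_reducts:
  "u \<in># reducts d t \<Longrightarrow> typing \<Gamma> t A \<Longrightarrow> develop d u = develop d t"
proof (induction t arbitrary: \<Gamma> A u)
  case (App t s)
  then obtain C where t: "typing \<Gamma> t (Fun C A)" and s: "typing \<Gamma> s C"
    by (auto elim: typing_AppE)
  have "develop d (contract t s) = app_deg d (develop d t) (develop d s)" if "m_abs_of_deg d t"
    using that typing_type_of[OF typing_develop[OF t, of d]] typing_type_of[OF t]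
      develop_contract[OF t s, of d] m_abs_develop[of t d]
    by (auto simp: m_abs_of_deg_def app_deg_def)
  then show ?case
    using App t s by (auto split: if_splits)
qed (auto elim!: typing_tmE)

lemma develop_reduces: "reduces d t u \<Longrightarrow> typable t \<Longrightarrow> develop d u = develop d t"
proof (induction rule: rtranclp_induct)
  case (step u v)
  then have "typable u" using typable_reduces by blast
  with step show ?case unfolding typable_def using develop_reducts by metis
qed simp


section \<open>Termination of the reduction of a given degree\<close>

primrec mem_count :: "'b tm \<Rightarrow> nat" where
  "mem_count (Var i A) = 0"
| "mem_count (Lam A t) = mem_count t"
| "mem_count (App t s) = mem_count t + mem_count s"
| "mem_count (Mem t s) = Suc (mem_count t + mem_count s)"

lemma mem_count_subst: "mem_count t \<le> mem_count (subst t k s)"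
  by (induction t arbitrary: k s) (auto intro: add_mono)

lemma mem_count_contract: "m_abs t \<Longrightarrow> mem_count t + mem_count s < mem_count (contract t s)"
  by (induction t) (auto simp: mem_count_subst less_Suc_eq_le)

lemma mem_count_reducts: "u \<in># reducts d t \<Longrightarrow> mem_count t < mem_count u"
  by (induction t arbitrary: u)
    (auto split: if_splits simp: m_abs_of_deg_def mem_count_contract)

lemma mem_count_reduces: "reduces d t u \<Longrightarrow> mem_count t \<le> mem_count u"
  by (induction rule: rtranclp_induct) (auto dest: mem_count_reducts)

text \<open>Steps of degree \<open>d\<close> add memory entries and never leave the terms that develop into
  \<open>develop d t\<close>, whose number of entries therefore bounds the length of every reduction.\<close>

lemma reducts_induct [consumes 1, case_names step]:
  assumes "typable t"
    and "\<And>t. typable t \<Longrightarrow> (\<And>u. u \<in># reducts d t \<Longrightarrow> P u) \<Longrightarrow> P t"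
  shows "P t"
  using assms(1)
proof (induction "mem_count (develop d t) - mem_count t" arbitrary: t rule: less_induct)
  case less
  show ?case
  proof (rule assms(2)[OF less.prems])
    fix u assume u: "u \<in># reducts d t"
    then have "develop d u = develop d t" and "typable u"
      using develop_reducts typable_reducts less.prems unfolding typable_def by blast+
    moreover have "mem_count u \<le> mem_count (develop d u)"
      by (rule mem_count_reduces[OF reduces_develop])
    ultimately show "P u"
      using mem_count_reducts[OF u] by (intro less.hyps) auto
  qed
qed


section \<open>Multiset orders\<close>

lemma multp_union: "multp R A B \<Longrightarrow> multp R (C + A) (C + B)"
  unfolding multp_def mult_def
  by (induction rule: trancl_induct) (auto intro: mult1_union trancl.intros)

lemma multp_transD: "multp R A B \<Longrightarrow> multp R B C \<Longrightarrow> multp R A C"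
  unfolding multp_def mult_def by (rule trancl_trans)

abbreviation multeqp :: "('a \<Rightarrow> 'a \<Rightarrow> bool) \<Rightarrow> 'a multiset \<Rightarrow> 'a multiset \<Rightarrow> bool" where
  "multeqp R \<equiv> (multp R)\<^sup>=\<^sup>="

lemma multeqp_trans: "multeqp R A B \<Longrightarrow> multeqp R B C \<Longrightarrow> multeqp R A C"
  by (auto intro: multp_transD)

lemma multeqp_add: "multeqp R A B \<Longrightarrow> multeqp R C D \<Longrightarrow> multeqp R (A + C) (B + D)"
  using multp_union[of R A B C] multp_union[of R C D B]
  by (auto simp: add.commute intro: multp_transD multp_union)

lemma multeqp_subset: "A \<subseteq># B \<Longrightarrow> multeqp R A B"
  by (auto simp: subset_mset.le_less intro: subset_implies_multp)

lemma multp_dominated: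
  "B \<noteq> {#} \<Longrightarrow> (\<And>a. a \<in># A \<Longrightarrow> \<exists>b\<in>#B. R a b) \<Longrightarrow> multp R A B"
  using one_step_implies_multp[of B A R "{#}"] by simp

lemma multeqp_sum:
  "(\<And>i. i \<in> I \<Longrightarrow> multeqp R (f i) (g i)) \<Longrightarrow> multeqp R (\<Sum>i\<in>I. f i) (\<Sum>i\<in>I. g i)"
proof (induction I rule: infinite_finite_induct)
  case (insert i I)
  then have "multeqp R (f i + (\<Sum>i\<in>I. f i)) (g i + (\<Sum>i\<in>I. g i))"
    by (intro multeqp_add) auto
  with insert.hyps show ?case by simp
qed simp_all

lemma multeqp_replicate:
  assumes "n \<le> m" "R\<^sup>=\<^sup>= a b"
  shows "multeqp R (replicate_mset n a) (replicate_mset m b)"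
proof -
  have "multeqp R (replicate_mset n a) (replicate_mset n b)"
    using assms(2) by (cases "n = 0") (auto intro!: multp_dominated)
  moreover have "multeqp R (replicate_mset n b) (replicate_mset m b)"
    using assms(1) by (intro multeqp_subset) (simp add: subseteq_mset_def count_replicate_mset)
  ultimately show ?thesis by (rule multeqp_trans)
qed

abbreviation pair_less :: "nat \<times> rval \<Rightarrow> nat \<times> rval \<Rightarrow> bool" where
  "pair_less \<equiv> (\<lambda>x y. fst x < fst y \<or> fst x = fst y \<and> less_R (snd x) (snd y))"

abbreviation le_T :: "tval \<Rightarrow> tval \<Rightarrow> bool" where "le_T \<equiv> less_T\<^sup>=\<^sup>="
abbreviation le_R :: "rval \<Rightarrow> rval \<Rightarrow> bool" where "le_R \<equiv> less_R\<^sup>=\<^sup>="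

lemma less_T_TV [simp]: "less_T (TV m) (TV n) \<longleftrightarrow> multp pair_less m n"
  by (simp add: less_T.simps)

lemma less_R_RV [simp]: "less_R (RV m) (RV n) \<longleftrightarrow> multp less_T m n"
  by (simp add: less_R.simps)

lemma less_T_trans: "less_T a b \<Longrightarrow> less_T b c \<Longrightarrow> less_T a c"
  by (cases a; cases b; cases c) (auto intro: multp_transD)

text \<open>\<open>embeds Q A B\<close>: some injection of the occurrences in \<open>A\<close> into those in \<open>B\<close> relates each
  element to its image by \<open>Q\<close>.\<close>

inductive embeds :: "('a \<Rightarrow> 'b \<Rightarrow> bool) \<Rightarrow> 'a multiset \<Rightarrow> 'b multiset \<Rightarrow> bool" for Q where
  embeds_empty: "embeds Q {#} B"
| embeds_add: "Q a b \<Longrightarrow> embeds Q A B \<Longrightarrow> embeds Q (add_mset a A) (add_mset b B)"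

lemma embeds_add_right: "embeds Q A B \<Longrightarrow> embeds Q A (B + C)"
  by (induction rule: embeds.induct) (auto intro: embeds.intros)

lemma embeds_subset: "embeds Q A B \<Longrightarrow> B \<subseteq># C \<Longrightarrow> embeds Q A C"
  using embeds_add_right[of Q A B "C - B"] by simp

lemma embeds_union: "embeds Q A B \<Longrightarrow> embeds Q A' B' \<Longrightarrow> embeds Q (A + A') (B + B')"
  by (induction rule: embeds.induct)
    (auto intro: embeds.intros simp: add.commute[of _ B'] embeds_add_right)

lemma embeds_image:
  assumes "embeds Q A B" "\<And>a b. a \<in># A \<Longrightarrow> b \<in># B \<Longrightarrow> Q a b \<Longrightarrow> Q' (f a) (g b)"
  shows "embeds Q' (image_mset f A) (image_mset g B)"
  using assms by (induction rule: embeds.induct) (auto intro: embeds.intros)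

lemma embeds_mono:
  assumes "embeds Q A B" "\<And>a b. a \<in># A \<Longrightarrow> b \<in># B \<Longrightarrow> Q a b \<Longrightarrow> Q' a b"
  shows "embeds Q' A B"
  using embeds_image[of Q A B Q' id id] assms by simp

lemma embeds_member: "embeds Q A B \<Longrightarrow> a \<in># A \<Longrightarrow> \<exists>b\<in>#B. Q a b"
  by (induction rule: embeds.induct) auto

lemma embeds_size: "embeds Q A B \<Longrightarrow> size A \<le> size B"
  by (induction rule: embeds.induct) auto

lemma embeds_sum:
  assumes "embeds Q A B" "\<And>a b. a \<in># A \<Longrightarrow> b \<in># B \<Longrightarrow> Q a b \<Longrightarrow> multeqp R (f a) (g b)"
  shows "multeqp R (\<Sum>a\<in>#A. f a) (\<Sum>b\<in>#B. g b)"
  using assms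
proof (induction rule: embeds.induct)
  case (embeds_empty B)
  then show ?case using multeqp_subset[of "{#}" "\<Sum>b\<in>#B. g b" R] by simp
next
  case (embeds_add a b A B)
  then have "multeqp R (f a + (\<Sum>a\<in>#A. f a)) (g b + (\<Sum>b\<in>#B. g b))"
    by (intro multeqp_add) auto
  then show ?case by simp
qed


section \<open>Structural description of the measures\<close>

lemma mset_set_UN_disjoint:
  assumes "finite I" "\<And>i. i \<in> I \<Longrightarrow> finite (A i)" "disjoint_family_on A I"
  shows "mset_set (\<Union>i\<in>I. A i) = (\<Sum>i\<in>I. mset_set (A i))"
  using assms
proof (induction I rule: finite_induct)
  case (insert i I)
  then have "A i \<inter> (\<Union>i\<in>I. A i) = {}" and "disjoint_family_on A I"
    by (auto simp: disjoint_family_on_def)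
  with insert show ?case by (simp add: mset_set_Union)
qed simp

lemma image_mset_sum: "image_mset f (\<Sum>i\<in>I. A i) = (\<Sum>i\<in>I. image_mset f (A i))"
  by (induction I rule: infinite_finite_induct) auto

lemma image_mset_sum_mset: "image_mset f (\<Sum>u\<in>#M. g u) = (\<Sum>u\<in>#M. image_mset f (g u))"
  by (induction M) auto

section \<open>Redex occurrences in structural form\<close>

lemma m_abs_iff_mems: "m_abs t \<longleftrightarrow> (\<exists>A u L. t = mems (Lam A u) L)"
proof
  show "m_abs t \<Longrightarrow> \<exists>A u L. t = mems (Lam A u) L"
  proof (induction t)
    case (Lam A t)
    show ?case by (intro exI[of _ A] exI[of _ t] exI[of _ "[]"]) (simp add: mems_def)
  next
    case (Mem t s)
    then obtain A u L where "t = mems (Lam A u) L" by auto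
    then have "Mem t s = mems (Lam A u) (L @ [s])" by (simp add: mems_def)
    then show ?case by blast
  qed auto
  have "m_abs (mems (Lam A u) L)" for A :: "'b ty" and u L
    by (induction L rule: rev_induct) (auto simp: mems_def)
  then show "\<exists>A u L. t = mems (Lam A u) L \<Longrightarrow> m_abs t" by blast
qed

lemma contract_mems: "contract (mems (Lam A t) L) s = mems (Mem (subst t 0 s) s) L"
  by (induction L rule: rev_induct) (auto simp: mems_def)

lemma mstep_root: "mstep [] d (App t s) u \<longleftrightarrow> m_abs_of_deg d t \<and> u = contract t s"
proof
  show "mstep [] d (App t s) u \<Longrightarrow> m_abs_of_deg d t \<and> u = contract t s"
    by (erule mstep_AppE) (auto simp: m_abs_of_deg_def m_abs_iff_mems contract_mems)
  assume "m_abs_of_deg d t \<and> u = contract t s"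
  then show "mstep [] d (App t s) u"
    by (auto simp: m_abs_of_deg_def m_abs_iff_mems contract_mems intro: mstep.intros(1))
qed

definition msteps :: "nat \<Rightarrow> 'b tm \<Rightarrow> (pos \<times> 'b tm) set" where
  "msteps d t = {(p, u). mstep p d t u}"

lemma msteps_Var: "msteps d (Var i A) = {}"
  by (auto simp: msteps_def elim: mstep_tmE)

lemma msteps_Lam: "msteps d (Lam A t) = (\<lambda>(p, u). (DBody # p, Lam A u)) ` msteps d t"
  by (auto simp: msteps_def image_iff elim!: mstep_tmE intro: mstep.intros)

lemma msteps_App: "msteps d (App t s) =
    (if m_abs_of_deg d t then {([], contract t s)} else {})
    \<union> (\<lambda>(p, u). (DLeft # p, App u s)) ` msteps d t \<union> (\<lambda>(p, u). (DRight # p, App t u)) ` msteps d s"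
  (is "?L = ?R")
proof (rule set_eqI)
  fix x :: "pos \<times> 'a tm"
  obtain p u where x: "x = (p, u)" by fastforce
  show "x \<in> ?L \<longleftrightarrow> x \<in> ?R"
  proof (cases p)
    case Nil
    with x show ?thesis by (auto simp: msteps_def mstep_root)
  next
    case (Cons a q)
    with x show ?thesis
      by (auto simp: msteps_def image_iff elim!: mstep_AppE intro: mstep.intros)
  qed
qed

lemma msteps_Mem: "msteps d (Mem t s) =
    (\<lambda>(p, u). (DLeft # p, Mem u s)) ` msteps d t \<union> (\<lambda>(p, u). (DRight # p, Mem t u)) ` msteps d s"
  by (auto simp: msteps_def image_iff elim!: mstep_tmE intro: mstep.intros)

lemmas msteps_simps = msteps_Var msteps_Lam msteps_App msteps_Mem

lemma finite_msteps: "finite (msteps d t)"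
  by (induction t) (auto simp: msteps_simps)

lemma mset_set_msteps_image:
  "inj f \<Longrightarrow> image_mset snd (mset_set ((\<lambda>(p, u). (a # p, f u)) ` msteps d t))
    = image_mset f (image_mset snd (mset_set (msteps d t)))"
  by (subst image_mset_mset_set [symmetric])
    (auto simp: inj_on_def image_mset.compositionality o_def case_prod_beta)

text \<open>Positions keep equal results of different redexes apart. Those at the root and in the
  two immediate subterms form disjoint sets, so \<open>mset_set\<close> turns their union into the
  sum that defines \<open>reducts\<close>.\<close>

lemma reducts_eq: "reducts d t = image_mset snd (mset_set (msteps d t))"
proof (induction t)
  case (Lam A t)
  then show ?case
    by (simp add: msteps_simps mset_set_msteps_image inj_def)
next
  case (App t s)
  let ?A = "if m_abs_of_deg d t then {([], contract t s)} else {}"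
  let ?B = "(\<lambda>(p, u). (DLeft # p, App u s)) ` msteps d t"
  let ?C = "(\<lambda>(p, u). (DRight # p, App t u)) ` msteps d s"
  have "mset_set (?A \<union> ?B \<union> ?C) = mset_set ?A + mset_set ?B + mset_set ?C"
  proof -
    have "?A \<inter> ?B = {}" "(?A \<union> ?B) \<inter> ?C = {}" "finite ?A" "finite ?B" "finite ?C"
      by (auto simp: finite_msteps)
    then show ?thesis by (metis mset_set_Union finite_Un)
  qed
  with App show ?case
    by (simp add: msteps_simps mset_set_msteps_image inj_def)
next
  case (Mem t s)
  let ?B = "(\<lambda>(p, u). (DLeft # p, Mem u s)) ` msteps d t"
  let ?C = "(\<lambda>(p, u). (DRight # p, Mem t u)) ` msteps d s"
  have "mset_set (?B \<union> ?C) = mset_set ?B + mset_set ?C"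
    by (subst mset_set_Union) (auto simp: finite_msteps)
  with Mem show ?case
    by (simp add: msteps_simps mset_set_msteps_image inj_def)
qed (simp add: msteps_simps)

lemma in_reducts_iff: "u \<in># reducts d t \<longleftrightarrow> (\<exists>p. mstep p d t u)"
  using finite_msteps[of d t] by (auto simp: reducts_eq msteps_def image_iff)

declare measure_T.simps [simp del]

text \<open>Redexes of equal degree contribute equal pairs, so only their number matters. The
  summand for \<open>d = 0\<close> is empty because abstractions have types of positive
  height.\<close>

lemma measure_T_eq:
  "measure_T D t = TV (\<Sum>d\<le>D. replicate_mset (size (reducts d t)) (d, measure_R d t))"
proof -
  define occs where "occs d = (\<lambda>(p, u). (p, d)) ` msteps d t" for d
  have occs: "mset_set (occs d) = image_mset (\<lambda>(p, u). (p, d)) (mset_set (msteps d t))" for d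
    unfolding occs_def
    by (rule image_mset_mset_set [symmetric]) (auto simp: inj_on_def msteps_def dest: mstep_deterministic)
  have "{(p, d) \<in> redex_occs t. d \<le> D} = (\<Union>d\<in>{..D}. occs d)"
    by (force simp: redex_occs_def occs_def msteps_def)
  also have "mset_set \<dots> = (\<Sum>d\<le>D. mset_set (occs d))"
    by (rule mset_set_UN_disjoint) (auto simp: occs_def finite_msteps disjoint_family_on_def)
  finally show ?thesis
    by (simp add: measure_T.simps image_mset_sum occs image_mset.compositionality o_def
        case_prod_beta image_mset_const_eq reducts_eq)
qed

section \<open>Reductions of a fixed degree\<close>

lemma mreduction_Nil: "mreduction d t [] v \<longleftrightarrow> v = t"
  by (auto elim: mreduction.cases intro: mreduction.intros)

lemma mreduction_Cons: "mreduction d t (p # ps) v \<longleftrightarrow> (\<exists>u. mstep p d t u \<and> mreduction d u ps v)"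
  by (auto elim: mreduction.cases intro: mreduction.intros)

definition reach :: "nat \<Rightarrow> 'b tm \<Rightarrow> 'b tm multiset" where
  "reach d t = image_mset snd (mset_set (mreductions d t))"

lemma mreductions_unfold: "mreductions d t =
    insert ([], t) (\<Union>x\<in>msteps d t. (\<lambda>(ps, v). (fst x # ps, v)) ` mreductions d (snd x))"
proof (rule set_eqI)
  fix x :: "pos list \<times> 'a tm"
  obtain ps v where x: "x = (ps, v)" by fastforce
  show "x \<in> mreductions d t \<longleftrightarrow> x \<in> insert ([], t)
      (\<Union>x\<in>msteps d t. (\<lambda>(ps, v). (fst x # ps, v)) ` mreductions d (snd x))"
    by (cases ps) (force simp: x mreductions_def msteps_def mreduction_Nil mreduction_Cons)+
qed

text \<open>Finite branching together with termination. Without finiteness \<open>mset_set\<close>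
  would collapse to the empty multiset.\<close>

lemma finite_mreductions: "typable t \<Longrightarrow> finite (mreductions d t)"
proof (induction t rule: reducts_induct[where d = d])
  case (step t)
  have "finite (mreductions d (snd x))" if "x \<in> msteps d t" for x
    using that by (intro step.IH) (auto simp: in_reducts_iff msteps_def)
  then show ?case
    by (subst mreductions_unfold) (simp add: finite_msteps)
qed

text \<open>A reduction is empty or a first step followed by a reduction from its result. The first
  position determines the step, so the families for different steps are disjoint and multiplicities
  add up.\<close>

lemma reach_unfold:
  fixes t :: "'b tm"
  assumes "typable t"
  shows "reach d t = add_mset t (\<Sum>u\<in>#reducts d t. reach d u)"
proof -
  define ext :: "pos \<times> 'b tm \<Rightarrow> (pos list \<times> 'b tm) set"
    where "ext x = (\<lambda>(ps, v). (fst x # ps, v)) ` mreductions d (snd x)" for x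
  have fin: "finite (ext x)" if "x \<in> msteps d t" for x
  proof -
    from that have "snd x \<in># reducts d t" by (auto simp: in_reducts_iff msteps_def)
    with assms have "typable (snd x)" by (rule typable_reducts[rotated])
    then show ?thesis by (simp add: ext_def finite_mreductions)
  qed
  have "mset_set (ext x) = image_mset (\<lambda>(ps, v). (fst x # ps, v)) (mset_set (mreductions d (snd x)))" for x
    unfolding ext_def by (rule image_mset_mset_set [symmetric]) (auto simp: inj_on_def)
  then have *: "image_mset snd (mset_set (ext x)) = reach d (snd x)" for x
    by (simp add: reach_def image_mset.compositionality o_def case_prod_beta)
  have "disjoint_family_on ext (msteps d t)"
    by (fastforce simp: disjoint_family_on_def ext_def msteps_def dest: mstep_deterministic)
  then have "mset_set (\<Union>x\<in>msteps d t. ext x) = (\<Sum>x\<in>msteps d t. mset_set (ext x))"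
    using fin by (intro mset_set_UN_disjoint finite_msteps)
  moreover have "([], t) \<notin> (\<Union>x\<in>msteps d t. ext x)" by (auto simp: ext_def)
  moreover have "mreductions d t = insert ([], t) (\<Union>x\<in>msteps d t. ext x)"
    unfolding ext_def by (rule mreductions_unfold)
  ultimately have "reach d t = add_mset t (image_mset snd (\<Sum>x\<in>msteps d t. mset_set (ext x)))"
    using fin finite_msteps[of d t] by (simp add: reach_def)
  also have "image_mset snd (\<Sum>x\<in>msteps d t. mset_set (ext x)) = (\<Sum>x\<in>msteps d t. reach d (snd x))"
    by (simp add: image_mset_sum *)
  also have "\<dots> = (\<Sum>u\<in>#reducts d t. reach d u)"
    by (simp add: sum_unfold_sum_mset reducts_eq image_mset.compositionality o_def)
  finally show ?thesis .
qed

lemma reach_iff: "typable t \<Longrightarrow> u \<in># reach d t \<longleftrightarrow> reduces d t u"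
proof (induction t rule: reducts_induct[where d = d])
  case (step t)
  then have "u \<in># reach d t \<longleftrightarrow> u = t \<or> (\<exists>v\<in>#reducts d t. reduces d v u)"
    by (auto simp: reach_unfold)
  also have "\<dots> \<longleftrightarrow> reduces d t u"
    by (auto intro: converse_rtranclp_into_rtranclp elim: converse_rtranclpE)
  finally show ?case .
qed

lemma measure_R_eq: "measure_R (Suc D) t = RV (image_mset (measure_T D) (reach (Suc D) t))"
  by (auto simp: reach_def image_mset.compositionality o_def intro!: image_mset_cong)


section \<open>Simulations\<close>

text \<open>Prefixing a fixed reduction from \<open>t\<close> to \<open>u\<close> is injective on
  the reductions from \<open>u\<close> and keeps their end terms.\<close>

lemma reach_reduces_subset:
  assumes "reduces d t u" "typable t"
  shows "reach d u \<subseteq># reach d t"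
  using assms
proof (induction rule: rtranclp_induct)
  case (step u v)
  then have "typable u" using typable_reduces by blast
  then have "reach d u = add_mset u (\<Sum>w\<in>#reducts d u. reach d w)" by (rule reach_unfold)
  moreover from step have "reach d v \<subseteq># (\<Sum>w\<in>#reducts d u. reach d w)"
    by (auto dest!: multi_member_split)
  ultimately have "reach d v \<subseteq># reach d u"
    by (metis add_mset_add_single mset_subset_eq_add_left subset_mset.order_trans)
  with step show ?case by (auto intro: subset_mset.order_trans)
qed simp

text \<open>Distinct redexes of \<open>s\<close> are answered by distinct redexes of
  \<open>t\<close>, and the answer \<open>v\<close> need only reduce further to some
  \<open>w\<close> related to \<open>u\<close>; these extra steps are harmless by
  \<open>reach_reduces_subset\<close>. The bound \<open>D\<close> admits relations that simulate
  only steps of low degree. The outer induction is on the degree, the inner one follows the steps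
  from \<open>s\<close>.\<close>

lemma measure_T_mono:
  fixes P :: "'b tm \<Rightarrow> 'b tm \<Rightarrow> bool"
  assumes sim: "\<And>s t d. P s t \<Longrightarrow> typable s \<Longrightarrow> typable t \<Longrightarrow> d < D \<Longrightarrow>
      embeds (\<lambda>u v. \<exists>w. reduces d v w \<and> P u w) (reducts d s) (reducts d t)"
    and "P s t" "typable s" "typable t" "d < D"
  shows "le_T (measure_T d s) (measure_T d t)"
  using assms(2-)
proof (induction d arbitrary: s t rule: less_induct)
  case (less d)
  have "multeqp less_T (image_mset (measure_T e) (reach (Suc e) s))
      (image_mset (measure_T e) (reach (Suc e) t))" if "e < d" for e
    using less.prems(2,1,3)
  proof (induction s arbitrary: t rule: reducts_induct[where d = "Suc e"])
    case (step s)
    let ?f = "\<lambda>t. image_mset (measure_T e) (reach (Suc e) t)"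
    have unfold: "?f t = {#measure_T e t#} + (\<Sum>u\<in>#reducts (Suc e) t. ?f u)"
      if "typable t" for t :: "'b tm"
      using that by (simp add: reach_unfold[of t] image_mset_sum_mset)
    have "le_T (measure_T e s) (measure_T e t)"
      using less.IH[OF \<open>e < d\<close>] step less.prems(4) \<open>e < d\<close> by auto
    then have "multeqp less_T {#measure_T e s#} {#measure_T e t#}"
      by (auto intro!: multp_dominated)
    moreover have "multeqp less_T (\<Sum>u\<in>#reducts (Suc e) s. ?f u) (\<Sum>u\<in>#reducts (Suc e) t. ?f u)"
    proof (rule embeds_sum[OF sim])
      fix u v
      assume u: "u \<in># reducts (Suc e) s" and v: "v \<in># reducts (Suc e) t"
        and "\<exists>w. reduces (Suc e) v w \<and> P u w"
      then obtain w where w: "reduces (Suc e) v w" "P u w" by blast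
      from v step have "typable v" by (auto intro: typable_reducts)
      with w have "typable w" by (auto intro: typable_reduces)
      with step u w have "multeqp less_T (?f u) (?f w)" by blast
      moreover have "multeqp less_T (?f w) (?f v)"
        using w(1) \<open>typable v\<close>
        by (intro multeqp_subset image_mset_subseteq_mono reach_reduces_subset)
      ultimately show "multeqp less_T (?f u) (?f v)" by (rule multeqp_trans)
    qed (use step less.prems(4) \<open>e < d\<close> in auto)
    ultimately show ?case
      unfolding unfold[OF step.hyps] unfold[OF step.prems(2)] by (rule multeqp_add)
  qed
  then have "le_R (measure_R (Suc e) s) (measure_R (Suc e) t)" if "e < d" for e
    using that by (auto simp: measure_R_eq simp del: measure_R.simps)
  \<comment> \<open>At degree \<open>0\<close> both sides are \<open>RV {#}\<close>.\<close>
  then have R: "le_R (measure_R e s) (measure_R e t)" if "e \<le> d" for e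
    using that by (cases e) (auto simp del: measure_R.simps(1))
  have "multeqp pair_less (\<Sum>e\<le>d. replicate_mset (size (reducts e s)) (e, measure_R e s))
      (\<Sum>e\<le>d. replicate_mset (size (reducts e t)) (e, measure_R e t))"
  proof (intro multeqp_sum multeqp_replicate)
    fix e assume "e \<in> {..d}"
    then show "size (reducts e s) \<le> size (reducts e t)"
      using less.prems by (intro embeds_size[OF sim]) auto
    show "pair_less\<^sup>=\<^sup>= (e, measure_R e s) (e, measure_R e t)"
      using R[of e] \<open>e \<in> {..d}\<close> by auto
  qed
  then show ?case by (auto simp: measure_T_eq)
qed

text \<open>Developing erases nothing: a redex of degree \<open>d < D\<close> leaves at least one
  copy in \<open>develop D t\<close>. Contracting a chosen copy and then the others leads to
  \<open>develop D u\<close>, and distinct redexes get distinct copies.\<close>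

lemma reducts_develop:
  "typing \<Gamma> t A \<Longrightarrow> d < D \<Longrightarrow>
    embeds (\<lambda>u v. reduces d v (develop D u)) (reducts d t) (reducts d (develop D t))"
proof (induction t arbitrary: \<Gamma> A)
  case (Var i C)
  then show ?case by (simp add: embeds_empty)
next
  case (Lam C t)
  then show ?case
    by (auto elim!: typing_LamE intro!: embeds_image reduces_Lam)
next
  case (Mem t s)
  then obtain B where "typing \<Gamma> t A" "typing \<Gamma> s B" by (auto elim: typing_MemE)
  with Mem show ?case
    by (auto intro!: embeds_union embeds_image reduces_Mem)
next
  case (App t s)
  then obtain C where t: "typing \<Gamma> t (Fun C A)" and s: "typing \<Gamma> s C"
    by (auto elim: typing_AppE)
  let ?t = "develop D t" and ?s = "develop D s"
  let ?Q = "\<lambda>u v. reduces d v (develop D u)"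
  note t' = typing_develop[OF t, of D] and s' = typing_develop[OF s, of D]
  note IH = App.IH(1)[OF t App.prems(2)] App.IH(2)[OF s App.prems(2)]
  note ty = typing_type_of[OF t] typing_type_of[OF t']
  have red: "reduces d ?t (develop D u)"
    if "v \<in># reducts d ?t" "reduces d v (develop D u)" for u v
    using that by (rule converse_rtranclp_into_rtranclp)
  show ?case
  proof (cases "m_abs_of_deg D ?t")
    case False
    have root: "embeds ?Q (if m_abs_of_deg d t then {#contract t s#} else {#})
        (if m_abs_of_deg d ?t then {#contract ?t ?s#} else {#})"
      using develop_contract[OF t s, of D] App.prems(2) ty m_abs_develop[of t D]
      by (auto simp: m_abs_of_deg_def intro!: embeds.intros)
    have left: "embeds ?Q (image_mset (\<lambda>u. App u s) (reducts d t))
        (image_mset (\<lambda>u. App u ?s) (reducts d ?t))"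
      using IH(1)
    proof (rule embeds_image)
      fix u v assume u: "u \<in># reducts d t" and v: "v \<in># reducts d ?t" "?Q u v"
      have "typing \<Gamma> (develop D u) (Fun C A)"
        using typing_reducts[OF u t] by (rule typing_develop)
      \<comment> \<open>The steps from \<open>?t\<close> to \<open>develop D u\<close> have degree
        \<open>d\<close> and create only abstractions of degree below \<open>d < D\<close>, so the
        outer application stays uncontracted in the development.\<close>
      then have "\<not> m_abs_of_deg D (develop D u)"
        using m_abs_created_reduces[OF red[OF v] t'] False App.prems(2) ty typing_type_of
        unfolding m_abs_of_deg_def by (metis less_asym)
      then show "?Q (App u s) (App v ?s)"
        using v by (simp add: app_deg_def reduces_App)
    qed
    have right: "embeds ?Q (image_mset (App t) (reducts d s)) (image_mset (App ?t) (reducts d ?s))"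
      using IH(2) by (rule embeds_image) (use False in \<open>auto simp: app_deg_def intro!: reduces_App\<close>)
    show ?thesis
      using embeds_union[OF embeds_union[OF root left] right] False by (simp add: app_deg_def)
  next
    case True
    then have m: "m_abs ?t" and D: "height (Fun C A) = D"
      using ty by (auto simp: m_abs_of_deg_def)
    \<comment> \<open>Here the development contracts the application itself; redexes of
      \<open>s\<close> are matched with redexes in the copy of \<open>?s\<close> stored by this
      contraction.\<close>
    obtain g where g: "image_mset (\<lambda>u. contract u ?s) (reducts d ?t) + image_mset g (reducts d ?s)
        \<subseteq># reducts d (contract ?t ?s)" "\<forall>r\<in>#reducts d ?s. reduces d (g r) (contract ?t r)"
      using reducts_contract[OF t' s' m] by blast
    have left: "embeds ?Q (image_mset (\<lambda>u. App u s) (reducts d t))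
        (image_mset (\<lambda>u. contract u ?s) (reducts d ?t))"
      using IH(1)
    proof (rule embeds_image)
      fix u v assume u: "u \<in># reducts d t" and v: "v \<in># reducts d ?t" "?Q u v"
      have "typing \<Gamma> (develop D u) (Fun C A)"
        using typing_reducts[OF u t] by (rule typing_develop)
      then have "m_abs_of_deg D (develop D u)"
        using m_abs_reduces[OF red[OF v] m] D typing_type_of unfolding m_abs_of_deg_def by metis
      moreover have "reduces d (contract v ?s) (contract (develop D u) ?s)"
        using v(2) typing_reducts[OF v(1) t'] s' m_abs_reducts[OF v(1) m]
        by (rule reduces_contract_left)
      ultimately show "?Q (App u s) (contract v ?s)"
        by (simp add: app_deg_def)
    qed
    have right: "embeds ?Q (image_mset (App t) (reducts d s)) (image_mset g (reducts d ?s))"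
      using IH(2)
    proof (rule embeds_image)
      fix u v assume v: "v \<in># reducts d ?s" "?Q u v"
      then have "reduces d (g v) (contract ?t (develop D u))"
        using g(2) reduces_contract_right[OF v(2)] by (metis (no_types, lifting) rtranclp_trans)
      then show "?Q (App t u) (g v)"
        using True by (simp add: app_deg_def)
    qed
    have "\<not> m_abs_of_deg d t"
      using App.prems(2) D ty by (auto simp: m_abs_of_deg_def)
    then show ?thesis
      using embeds_subset[OF embeds_union[OF left right] g(1)] True by (simp add: app_deg_def)
  qed
qed

section \<open>Erasing memory entries\<close>

inductive erases :: "'b tm \<Rightarrow> 'b tm \<Rightarrow> bool" where
  "erases (Var i A) (Var i A)"
| "erases t t' \<Longrightarrow> erases (Lam A t) (Lam A t')"
| "erases t t' \<Longrightarrow> erases s s' \<Longrightarrow> erases (App t s) (App t' s')"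
| "erases t t' \<Longrightarrow> erases s s' \<Longrightarrow> erases (Mem t s) (Mem t' s')"
| "erases t t' \<Longrightarrow> erases (Mem t s) t'"

lemma erases_refl [simp]: "erases t t"
  by (induction t) (auto intro: erases.intros)

lemma erases_lift: "erases t t' \<Longrightarrow> erases (lift t k) (lift t' k)"
  by (induction arbitrary: k rule: erases.induct) (auto intro: erases.intros)

text \<open>Substitution may copy \<open>s\<close> many times and every copy must be erased to
  \<open>s'\<close>, which is why \<open>erases\<close> drops any number of entries at once.\<close>

lemma erases_subst: "erases t t' \<Longrightarrow> erases s s' \<Longrightarrow> erases (subst t k s) (subst t' k s')"
proof (induction arbitrary: k s s' rule: erases.induct)
  case (2 t t' A)
  then show ?case by (simp add: erases.intros erases_lift)
qed (auto intro: erases.intros)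

lemma erases_type_of: "erases t t' \<Longrightarrow> type_of t' = type_of t"
  by (induction rule: erases.induct) auto

lemma erases_m_abs: "erases t t' \<Longrightarrow> m_abs t' \<Longrightarrow> m_abs t"
  by (induction rule: erases.induct) auto

lemma erases_contract:
  "erases t t' \<Longrightarrow> m_abs t' \<Longrightarrow> erases s s' \<Longrightarrow> erases (contract t s) (contract t' s')"
  by (induction rule: erases.induct) (auto intro: erases.intros erases_subst)

text \<open>Each redex that remains after erasing stems from a redex of its own, of the same degree
  because types are preserved; redexes inside dropped entries are left unmatched.\<close>

lemma erases_reducts: "erases t t' \<Longrightarrow> embeds (\<lambda>u v. erases v u) (reducts d t') (reducts d t)"
proof (induction rule: erases.induct)
  case (1 i A)
  show ?case by (simp add: embeds_empty)
next
  case (2 t t' A)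
  then show ?case by (auto intro!: embeds_image erases.intros)
next
  case (3 t t' s s')
  have "embeds (\<lambda>u v. erases v u) (if m_abs_of_deg d t' then {#contract t' s'#} else {#})
      (if m_abs_of_deg d t then {#contract t s#} else {#})"
    using 3 by (auto simp: m_abs_of_deg_def erases_type_of erases_m_abs
        intro!: embeds.intros erases_contract)
  moreover have "embeds (\<lambda>u v. erases v u) (image_mset (\<lambda>u. App u s') (reducts d t'))
      (image_mset (\<lambda>u. App u s) (reducts d t))"
    using 3(3) by (rule embeds_image) (auto intro: erases.intros 3)
  moreover have "embeds (\<lambda>u v. erases v u) (image_mset (App t') (reducts d s'))
      (image_mset (App t) (reducts d s))"
    using 3(4) by (rule embeds_image) (auto intro: erases.intros 3)
  ultimately show ?case
    unfolding reducts.simps by (intro embeds_union)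
next
  case (4 t t' s s')
  then show ?case by (auto intro!: embeds_union embeds_image intro: erases.intros)
next
  case (5 t t' s)
  have "embeds (\<lambda>u v. erases v u) (reducts d t') (image_mset (\<lambda>u. Mem u s) (reducts d t))"
    using embeds_image[OF 5(2), where f = id and g = "\<lambda>u. Mem u s" and Q' = "\<lambda>u v. erases v u"]
    by (simp add: erases.intros)
  then show ?case by (auto intro: embeds_add_right)
qed


section \<open>Steps decrease the measures\<close>

lemma reducts_0 [simp]: "reducts 0 t = {#}"
  by (induction t) (auto simp: m_abs_of_deg_def dest: m_abs_height_pos)

lemma reducts_subst_empty:
  assumes "typing (\<Gamma> @ A # \<Delta>) t B" "typing (\<Gamma> @ \<Delta>) s A" "height A < d"
    and "reducts d t = {#}" "reducts d s = {#}"
  shows "reducts d (subst t (length \<Gamma>) s) = {#}"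
  using assms(1,2,4,5)
proof (induction t arbitrary: \<Gamma> B s)
  case (Lam C t)
  then obtain B' where "typing ((C # \<Gamma>) @ A # \<Delta>) t B'"
    by (auto elim: typing_LamE)
  moreover have "typing ((C # \<Gamma>) @ \<Delta>) (lift s 0) A"
    using typing_lift[of "[]"] Lam.prems by simp
  ultimately have "reducts d (subst t (length (C # \<Gamma>)) (lift s 0)) = {#}"
    by (rule Lam.IH) (use Lam.prems in \<open>auto simp: reducts_lift\<close>)
  then show ?case by simp
next
  case (App t r)
  then obtain C where t: "typing (\<Gamma> @ A # \<Delta>) t (Fun C B)" and r: "typing (\<Gamma> @ A # \<Delta>) r C"
    by (auto elim: typing_AppE)
  have "\<not> m_abs_of_deg d t" using App.prems by auto
  then have "\<not> m_abs_of_deg d (subst t (length \<Gamma>) s)"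
    using m_abs_subst_typing[OF t, of s] assms(3)
      typing_type_of[OF t] typing_type_of[OF typing_subst[OF t App.prems(2)]]
    unfolding m_abs_of_deg_def by (metis less_irrefl)
  then show ?case
    using App.IH(1)[OF t App.prems(2)] App.IH(2)[OF r App.prems(2)] App.prems by auto
qed (auto elim!: typing_tmE)

lemma reducts_contract_empty:
  assumes "typing \<Gamma> t (Fun A B)" "typing \<Gamma> s A" "height A < d" "m_abs t"
    and "reducts d t = {#}" "reducts d s = {#}"
  shows "reducts d (contract t s) = {#}"
  using assms
proof (induction t)
  case (Lam C t)
  then show ?case
    using reducts_subst_empty[of "[]" A \<Gamma> t B s d] by (auto elim!: typing_LamE)
qed (auto elim: typing_MemE)

text \<open>The head of a created redex is either a substituted copy of the argument or the
  contractum itself. Their types are the two proper parts of a type of height \<open>d\<close>, so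
  the created redex has degree below \<open>d\<close>; copies of old redexes keep their
  degree.\<close>

lemma reducts_empty_step:
  assumes "u \<in># reducts d t" "typing \<Gamma> t A" "d < D" "reducts D t = {#}"
  shows "reducts D u = {#}"
  using assms
proof (induction t arbitrary: \<Gamma> A u)
  case (App t s)
  then obtain C where t: "typing \<Gamma> t (Fun C A)" and s: "typing \<Gamma> s C"
    by (auto elim: typing_AppE)
  have "reducts D (contract t s) = {#}" if "m_abs_of_deg d t"
    using that typing_type_of[OF t] App.prems
    by (intro reducts_contract_empty[OF t s]) (auto simp: m_abs_of_deg_def)
  moreover have "\<not> m_abs_of_deg D u'" if "u' \<in># reducts d t" for u'
    using m_abs_created[OF that t] typing_type_of[OF t] typing_type_of[OF typing_reducts[OF that t]]
      App.prems(3,4) by (auto simp: m_abs_of_deg_def split: if_splits)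
  ultimately show ?case
    using App t s by (auto split: if_splits)
qed (auto elim!: typing_tmE)

lemma measure_T_step:
  "typable t \<Longrightarrow> u \<in># reducts d t \<Longrightarrow> d \<le> D \<Longrightarrow> less_T (measure_T D u) (measure_T D t)"
proof (induction D arbitrary: t u d rule: less_induct)
  case (less D)
  obtain \<Gamma> A where t: "typing \<Gamma> t A" using less.prems(1) by (auto simp: typable_def)
  have u: "typable u" using less.prems by (auto intro: typable_reducts)
  have R: "less_R (measure_R D' u) (measure_R D' t)" if D': "d \<le> D'" "D' \<le> D" for D'
  proof -
    have "D' \<noteq> 0" using D' less.prems(2) by (cases d) auto
    then obtain e where e: "D' = Suc e" by (cases D') auto
    let ?f = "image_mset (measure_T e)"
    have "multp less_T (?f (reach (Suc e) u)) (?f (reach (Suc e) t))"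
    proof (cases "d = Suc e")
      case True
      \<comment> \<open>Reductions from \<open>u\<close> are prefixed with the step to
        \<open>u\<close>. The empty reduction from \<open>t\<close> is not among the results, which
        makes the inclusion proper.\<close>
      have "reach d u \<subseteq># (\<Sum>w\<in>#reducts d t. reach d w)"
        using less.prems(2) by (auto dest!: multi_member_split)
      then have "reach d u \<subset># reach d t"
        by (simp add: reach_unfold[OF less.prems(1), of d] subset_mset.le_less_trans)
      then show ?thesis
        using True by (intro subset_implies_multp image_mset_subset_mono) simp
    next
      case False
      with e D' have de: "d \<le> e" "e < D" by auto
      have le: "le_T (measure_T e y) (measure_T e x)" if "reduces d x y" "typable x" for x y :: "'a tm"
        using that
      proof (induction rule: rtranclp_induct)
        case (step y z)
        then have "typable y" using typable_reduces by blast
        then have "less_T (measure_T e z) (measure_T e y)"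
          using less.IH[OF de(2) _ step.hyps(2) de(1)] by blast
        with step show ?case by (auto intro: less_T_trans)
      qed simp
      let ?t = "develop (Suc e) t"
      have "typable ?t" using less.prems(1) by (rule typable_develop)
      have "\<exists>b\<in>#?f (reach (Suc e) t). less_T a b" if "a \<in># ?f (reach (Suc e) u)" for a
      proof -
        from that obtain s where s: "reduces (Suc e) u s" "a = measure_T e s"
          using reach_iff[OF u] by auto
        then have "typable s" using u typable_reduces by blast
        \<comment> \<open>Passing to the normal form of degree \<open>Suc e\<close> does not lower
          \<open>measure_T e\<close>, and this normal form is the same for every such
          \<open>s\<close>.\<close>
        have "le_T a (measure_T e (develop (Suc e) s))"
          unfolding s(2)
        proof (rule measure_T_mono[where P = "\<lambda>x y. y = develop (Suc e) x" and D = "Suc e"])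
          fix x y :: "'a tm" and d
          assume "y = develop (Suc e) x" "typable x" "d < Suc e"
          then show "embeds (\<lambda>u v. \<exists>w. reduces d v w \<and> w = develop (Suc e) u) (reducts d x) (reducts d y)"
            using reducts_develop by (auto simp: typable_def)
        qed (use \<open>typable s\<close> in \<open>auto intro: typable_develop\<close>)
        also have "develop (Suc e) s = develop (Suc e) u"
          using s(1) u by (rule develop_reduces)
        finally have a: "le_T a (measure_T e (develop (Suc e) u))" .
        \<comment> \<open>The step from \<open>t\<close> to \<open>u\<close> has a counterpart
          starting from \<open>?t\<close>; this first step to \<open>v\<close> makes the comparison
          strict.\<close>
        obtain v where v: "v \<in># reducts d ?t" "reduces d v (develop (Suc e) u)"
          using embeds_member[OF reducts_develop[OF t, of d "Suc e"] less.prems(2)] de(1) by auto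
        then have "typable v" using \<open>typable ?t\<close> typable_reducts by blast
        then have "le_T (measure_T e (develop (Suc e) u)) (measure_T e v)"
          using le v(2) by blast
        moreover have "less_T (measure_T e v) (measure_T e ?t)"
          using less.IH[OF de(2) \<open>typable ?t\<close> v(1) de(1)] .
        ultimately have "less_T a (measure_T e ?t)"
          using a less_T_trans by auto
        moreover have "?t \<in># reach (Suc e) t"
          using less.prems(1) reduces_develop by (simp add: reach_iff)
        ultimately show ?thesis by auto
      qed
      then show ?thesis
        using reach_unfold[OF less.prems(1), of "Suc e"] by (intro multp_dominated) auto
    qed
    then show ?thesis by (simp add: e measure_R_eq del: measure_R.simps)
  qed
  let ?M = "\<lambda>t. \<Sum>e\<le>D. replicate_mset (size (reducts e t)) (e, measure_R e t)"
  have in_M: "x \<in># ?M t \<longleftrightarrow> (\<exists>e\<le>D. reducts e t \<noteq> {#} \<and> x = (e, measure_R e t))" for x t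
    by (fastforce simp: set_mset_sum)
  have d: "(d, measure_R d t) \<in># ?M t"
    using less.prems unfolding in_M by auto
  have "multp pair_less (?M u) (?M t)"
  proof (rule multp_dominated)
    show "?M t \<noteq> {#}" using d by auto
    fix x assume "x \<in># ?M u"
    then obtain e where e: "e \<le> D" "reducts e u \<noteq> {#}" "x = (e, measure_R e u)"
      unfolding in_M by blast
    \<comment> \<open>A pair of degree above \<open>d\<close> lies below one of the same degree in
      \<open>t\<close>, which exists since the step creates no redex of higher degree; any other
      pair lies below that of the contracted redex.\<close>
    show "\<exists>y\<in>#?M t. pair_less x y"
    proof (cases "d < e")
      case True
      then have "reducts e t \<noteq> {#}"
        using reducts_empty_step[OF less.prems(2) t] e(2) by blast
      with e True R[of e] show ?thesis
        by (intro bexI[of _ "(e, measure_R e t)"]) (auto simp: in_M)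
    next
      case False
      with e less.prems(3) R[of d] d show ?thesis
        by (intro bexI[of _ "(d, measure_R d t)"]) (auto simp: not_less_iff_gr_or_eq)
    qed
  qed
  then show ?case by (simp add: measure_T_eq)
qed

text \<open>The step with memory differs from the beta step only by the stored argument, which
  erasing removes.\<close>

lemma beta_reducts: "M \<rightarrow>\<^sub>\<beta> N \<Longrightarrow> \<exists>d. \<exists>t\<in>#reducts d M. erases t N"
proof (induction rule: beta.induct)
  case (1 A t s)
  show ?case
    by (rule exI[of _ "height (type_of (Lam A t))"])
      (auto simp: m_abs_of_deg_def intro: erases.intros)
next
  case (2 t t' A)
  then obtain d u where "u \<in># reducts d t" "erases u t'" by blast
  then show ?case by (intro exI[of _ d] bexI[of _ "Lam A u"]) (auto intro: erases.intros)
next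
  case (3 t t' s)
  then obtain d u where "u \<in># reducts d t" "erases u t'" by blast
  then show ?case by (intro exI[of _ d] bexI[of _ "App u s"]) (auto intro: erases.intros)
next
  case (4 s s' t)
  then obtain d u where "u \<in># reducts d s" "erases u s'" by blast
  then show ?case by (intro exI[of _ d] bexI[of _ "App t u"]) (auto intro: erases.intros)
qed

lemma measure_m_eq:
  assumes "maxdeg t \<le> D"
  shows "measure_m t = measure_T D t"
proof -
  have "d \<le> maxdeg t" if "(p, d) \<in> redex_occs t" for p d
    unfolding maxdeg_def using that finite_redex_occs[of t] by (intro Max_ge) (auto intro: rev_image_eqI)
  with assms have "{(p, d) \<in> redex_occs t. d \<le> maxdeg t} = {(p, d) \<in> redex_occs t. d \<le> D}"
    by (auto dest: order_trans)
  then show ?thesis by (simp add: measure_m_def measure_T.simps)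
qed

lemma reducts_maxdeg:
  assumes "u \<in># reducts d t"
  shows "d \<le> maxdeg t"
proof -
  from assms obtain p where "(p, d) \<in> redex_occs t"
    by (auto simp: in_reducts_iff redex_occs_def)
  then show ?thesis
    unfolding maxdeg_def using finite_redex_occs[of t] by (intro Max_ge) (auto intro: rev_image_eqI)
qed

theorem theorem32:
  fixes M N :: "'b tm"
  assumes "lambda_term M" and "typable M"
    and "lambda_term N" and "typable N"
    and "M \<rightarrow>\<^sub>\<beta> N"
  shows "less_T (measure_m N) (measure_m M)"
proof -
  obtain d t where t: "t \<in># reducts d M" "erases t N"
    using beta_reducts[OF assms(5)] by blast
  \<comment> \<open>Each measure is cut off at the maximal degree of its own term. By
    \<open>measure_m_eq\<close> both can be read at a common bound.\<close>
  define D where "D = max (maxdeg M) (maxdeg N)"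
  have "le_T (measure_T D N) (measure_T D t)"
  \<comment> \<open>The erased term is the smaller one, hence the swapped arguments of
    \<open>erases\<close>; the bound on degrees is strict, hence \<open>Suc D\<close>.\<close>
  proof (rule measure_T_mono[where P = "\<lambda>s t. erases t s" and D = "Suc D"])
    fix s t :: "'b tm" and d
    assume "erases t s"
    then show "embeds (\<lambda>u v. \<exists>w. reduces d v w \<and> erases w u) (reducts d s) (reducts d t)"
      by (rule embeds_mono[OF erases_reducts]) auto
  qed (use t assms typable_reducts in auto)
  moreover have "less_T (measure_T D t) (measure_T D M)"
    using reducts_maxdeg[OF t(1)] by (intro measure_T_step[OF assms(2) t(1)]) (simp add: D_def)
  ultimately have "less_T (measure_T D N) (measure_T D M)"
    using less_T_trans by auto
  then show ?thesis
    by (simp add: measure_m_eq[of M D] measure_m_eq[of N D] D_def)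
qed

end
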